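(* Every pair of $k$-stars whose union is $(k+1)$-crossing-free have a unique common bisector.
   Context: Points are vertices of a convex $n$-gon on the unit circle labelled counterclockwise by $\mathbb{Z}_n$ ($n\ge 2k+1$); $u\prec v\prec w$ denotes counterclockwise cyclic order. Two edges cross if their open segments intersect; an $\ell$-crossing is a set of $\ell$ mutually crossing edges. A $k$-star is a set of edges $\{[s_j,s_{j+k}]: j\in\mathbb{Z}_{2k+1}\}$ with $s_0\prec s_1\prec\dots\prec s_{2k}\prec s_0$. An angle $\angle(u,v,w)$ of an edge set $E$ is a pair $\{[u,v],[v,w]\}\subseteq E$ with $u\prec v\prec w$ such that no edge $[v,t]$ with $w\prec t\prec u$ belongs to $E$; for such $t$ the edge $[v,t]$ is a bisector of the angle. A bisector of a $k$-star $S$ is a bisector of an angle of $S$ (viewed as an edge set). A common bisector of two $k$-stars is an edge that is a bisector of both. *)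

theory Defs
  imports "HOL-Analysis.Analysis"
begin

text \<open>
  The vertices of the polygon are referred to by their labels, the cyclic group of order \<open>n\<close> being
  represented by \<open>{..<n}\<close>; \<open>P i\<close> is the point carrying label \<open>i\<close>. The last condition says that the
  labels go around the circle only once.
\<close>

definition convex_ngon :: "nat \<Rightarrow> (nat \<Rightarrow> complex) \<Rightarrow> bool" where
  "convex_ngon n P \<longleftrightarrow>
     (\<exists>\<theta> :: nat \<Rightarrow> real.
        (\<forall>i<n. P i = cis (\<theta> i)) \<and>
        strict_mono_on {..<n} \<theta> \<and>
        (\<forall>i<n. \<forall>j<n. \<theta> j < \<theta> i + 2 * pi))"

definition ccw :: "nat \<Rightarrow> nat \<Rightarrow> nat \<Rightarrow> bool" where
  "ccw u v w \<longleftrightarrow> (u < v \<and> v < w) \<or> (v < w \<and> w < u) \<or> (w < u \<and> u < v)"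

text \<open>The edge \<open>[u, v]\<close> is the unordered pair \<open>{u, v}\<close> of labels.\<close>

definition crosses :: "(nat \<Rightarrow> complex) \<Rightarrow> nat set \<Rightarrow> nat set \<Rightarrow> bool" where
  "crosses P e f \<longleftrightarrow>
     (\<exists>u v w x. e = {u, v} \<and> f = {w, x} \<and>
        open_segment (P u) (P v) \<inter> open_segment (P w) (P x) \<noteq> {})"

definition is_crossing :: "(nat \<Rightarrow> complex) \<Rightarrow> nat \<Rightarrow> nat set set \<Rightarrow> bool" where
  "is_crossing P l C \<longleftrightarrow> finite C \<and> card C = l \<and> pairwise (crosses P) C"

definition crossing_free :: "(nat \<Rightarrow> complex) \<Rightarrow> nat \<Rightarrow> nat set set \<Rightarrow> bool" where
  "crossing_free P l E \<longleftrightarrow> \<not> (\<exists>C. C \<subseteq> E \<and> is_crossing P l C)"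

text \<open>
  The chain \<open>s 0 \<prec> s 1 \<prec> \<dots> \<prec> s (2k) \<prec> s 0\<close> has to be required for all triples of indices:
  consecutive triples alone would allow \<open>s\<close> to wind around the circle several times.
\<close>

definition k_star :: "nat \<Rightarrow> nat \<Rightarrow> nat set set \<Rightarrow> bool" where
  "k_star n k S \<longleftrightarrow>
     (\<exists>s :: nat \<Rightarrow> nat.
        (\<forall>j < 2 * k + 1. s j < n) \<and>
        (\<forall>h i j. h < i \<and> i < j \<and> j < 2 * k + 1 \<longrightarrow> ccw (s h) (s i) (s j)) \<and>
        S = {{s j, s ((j + k) mod (2 * k + 1))} | j. j < 2 * k + 1})"

definition is_angle :: "nat \<Rightarrow> nat set set \<Rightarrow> nat \<Rightarrow> nat \<Rightarrow> nat \<Rightarrow> bool" where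
  "is_angle n E u v w \<longleftrightarrow>
     u < n \<and> v < n \<and> w < n \<and> ccw u v w \<and> {u, v} \<in> E \<and> {v, w} \<in> E \<and>
     (\<forall>t<n. ccw w t u \<longrightarrow> {v, t} \<notin> E)"

definition is_bisector :: "nat \<Rightarrow> nat set set \<Rightarrow> nat set \<Rightarrow> bool" where
  "is_bisector n E b \<longleftrightarrow>
     (\<exists>u v w t. is_angle n E u v w \<and> t < n \<and> ccw w t u \<and> b = {v, t})"

definition common_bisector :: "nat \<Rightarrow> nat set set \<Rightarrow> nat set set \<Rightarrow> nat set \<Rightarrow> bool" where
  "common_bisector n R S b \<longleftrightarrow> is_bisector n R b \<and> is_bisector n S b"

end

theory Submission
  imports Defs
begin

text \<open>
  Unroll the circle: the vertices of a \<open>k\<close>-star become an increasing sequence \<open>a\<close> of integers with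
  \<open>a (i + (2 * k + 1)) = a i + n\<close>, its edges are the pairs \<open>(a i, a (i + k))\<close>, and its bisectors are
  the pairs \<open>(a i, t)\<close> with \<open>a (i + k) < t < a (i + k + 1)\<close>. In the plane these are the corners and
  the other lattice points of a monotone staircase that is invariant under the glide reflection
  \<open>(x, y) \<mapsto> (y, x + n)\<close>. Mutually crossing edges correspond to chains that increase in both
  coordinates. Without \<open>(k + 1)\<close>-crossings, two distinct staircases share no segment, so their common
  bisectors are exactly their transversal crossings. One exists because the glide reflection exchanges
  the two sides of a staircase, so that neither one stays above the other. If there were two,
  exchanging the staircases between them would give two chains of \<open>2 * k + 2\<close> edges in total, hence a
  \<open>(k + 1)\<close>-crossing.
\<close>

section \<open>Lifts of stars\<close>

definition star_lift :: "int \<Rightarrow> int \<Rightarrow> (int \<Rightarrow> int) \<Rightarrow> bool" where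
  "star_lift n k a \<longleftrightarrow> strict_mono a \<and> (\<forall>i. a (i + (2 * k + 1)) = a i + n)"

definition edge :: "int \<Rightarrow> int \<Rightarrow> int \<Rightarrow> nat set" where
  "edge n x y = {nat (x mod n), nat (y mod n)}"

definition star_edges :: "int \<Rightarrow> int \<Rightarrow> (int \<Rightarrow> int) \<Rightarrow> nat set set" where
  "star_edges n k a = range (\<lambda>i. edge n (a i) (a (i + k)))"

text \<open>Read in both orders of two distinct pairs, the inequalities say
  \<open>x < x' < y < y' < x + n\<close> up to exchanging the pairs, so the chords alternate around
  the circle. For a pair with itself they say \<open>x < y < x + n\<close>.\<close>

definition edge_chain :: "int \<Rightarrow> (int \<times> int) set \<Rightarrow> bool" where
  "edge_chain n T \<longleftrightarrow> finite T \<and>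
     (\<forall>(x, y)\<in>T. \<forall>(x', y')\<in>T. x < y' \<and> y < x' + n \<and>
        (x < x' \<and> y < y' \<or> x' < x \<and> y' < y \<or> x = x' \<and> y = y'))"

lemma star_lift_less: "star_lift n k a \<Longrightarrow> a i < a j \<longleftrightarrow> i < j"
  by (simp add: star_lift_def strict_mono_less)

lemma star_lift_le: "star_lift n k a \<Longrightarrow> a i \<le> a j \<longleftrightarrow> i \<le> j"
  by (simp add: star_lift_def strict_mono_less_eq)

lemma star_lift_eq: "star_lift n k a \<Longrightarrow> a i = a j \<longleftrightarrow> i = j"
  by (simp add: star_lift_def strict_mono_eq)

lemma star_lift_period: "star_lift n k a \<Longrightarrow> a (i + (2 * k + 1)) = a i + n"
  by (simp add: star_lift_def)

lemma star_lift_add_periods: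
  assumes "star_lift n k a"
  shows "a (i + q * (2 * k + 1)) = a i + q * n"
proof (induction q rule: int_induct[where k = 0])
  case base
  show ?case by simp
next
  case (step1 q)
  then show ?case
    using star_lift_period[OF assms, of "i + q * (2 * k + 1)"] by (simp add: algebra_simps)
next
  case (step2 q)
  then show ?case
    using star_lift_period[OF assms, of "i + (q - 1) * (2 * k + 1)"] by (simp add: algebra_simps)
qed

lemma star_lift_window:
  assumes "star_lift n k a" "i < j" "j < i + (2 * k + 1)"
  shows "a i < a j" "a j < a i + n"
  using assms star_lift_less[OF assms(1)] star_lift_period[OF assms(1), of i, symmetric] by auto

lemma star_lift_eq_mod:
  assumes "star_lift n k a" "x mod n = a i mod n"
  obtains q where "x = a (i + q * (2 * k + 1))"
proof -
  obtain q where "x = a i + q * n"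
    using assms(2) by (metis add.commute mod_eqE mult.commute)
  then show thesis using that star_lift_add_periods[OF assms(1)] by metis
qed

lemma star_lift_shift:
  "star_lift n k a \<Longrightarrow> star_lift n k (\<lambda>i. a (i + d))"
  unfolding star_lift_def strict_mono_def
  by (metis add.assoc add.commute add_strict_right_mono)

lemma star_edges_shift: "star_edges n k (\<lambda>i. a (i + d)) = star_edges n k a"
proof -
  have "edge n (a (i + d)) (a (i + k + d)) \<in> star_edges n k a" for i
    unfolding star_edges_def by (rule range_eqI[of _ _ "i + d"]) (simp add: algebra_simps)
  moreover have "edge n (a i) (a (i + k)) \<in> star_edges n k (\<lambda>i. a (i + d))" for i
    unfolding star_edges_def by (rule range_eqI[of _ _ "i - d"]) (simp add: algebra_simps)
  ultimately show ?thesis unfolding star_edges_def by fastforce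
qed

text \<open>A strictly monotone sequence of integers moves by at least one per step, so
  \<open>a\<close> is unbounded in both directions.\<close>

lemma star_lift_floor:
  assumes "star_lift n k a"
  shows "\<exists>i. a i \<le> x \<and> x < a (i + 1)"
proof -
  have grow: "a i + int d \<le> a (i + int d)" for i d
  proof (induction d)
    case (Suc d)
    have "a (i + int d) < a (i + int (Suc d))" using star_lift_less[OF assms] by simp
    with Suc show ?case by linarith
  qed simp
  define m where "m = nat (\<bar>x\<bar> + \<bar>a 0\<bar> + 1)"
  have lo: "a (- int m) \<le> x" using grow[of "- int m" m] unfolding m_def by simp
  have hi: "x < a (int m)" using grow[of 0 m] unfolding m_def by simp
  show ?thesis
  proof (rule ccontr)
    assume no: "\<not> ?thesis"
    have "a (- int m + int d) \<le> x" for d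
    proof (induction d)
      case 0
      show ?case using lo by simp
    next
      case (Suc d)
      then have "\<not> x < a (- int m + int d + 1)" using no by blast
      then show ?case by (simp add: algebra_simps)
    qed
    from this[of "2 * m"] hi show False by simp
  qed
qed

section \<open>Edges and their representatives on the unrolled circle\<close>

lemma edge_commute: "edge n x y = edge n y x"
  by (auto simp: edge_def)

lemma edge_eq_iff:
  "0 < n \<Longrightarrow> edge n x y = edge n x' y' \<longleftrightarrow>
     x mod n = x' mod n \<and> y mod n = y' mod n \<or> x mod n = y' mod n \<and> y mod n = x' mod n"
  by (simp add: edge_def doubleton_eq_iff eq_nat_nat_iff)

lemma edge_add_period: "edge n (x + n) y = edge n x y" "edge n x (y + n) = edge n x y"
  by (simp_all add: edge_def)

lemma star_edges_lower: "edge n (a i) (a (i + k)) \<in> star_edges n k a"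
  by (simp add: star_edges_def)

text \<open>From \<open>a (i + k + 1)\<close>, another \<open>k\<close> steps lead to
  \<open>a i + n\<close>, so this is an edge of the defining form read from its other end.\<close>

lemma star_edges_upper:
  assumes "star_lift n k a"
  shows "edge n (a i) (a (i + k + 1)) \<in> star_edges n k a"
proof -
  have "a (i + k + 1 + k) = a i + n"
    using star_lift_period[OF assms, of i] by (simp add: algebra_simps)
  then show ?thesis
    using star_edges_lower[of n a "i + k + 1" k] by (simp add: edge_add_period edge_commute)
qed

text \<open>Up to periods, \<open>a i\<close> occurs once as first and once as second endpoint of a
  pair \<open>(a m, a (m + k))\<close>; each occurrence gives one neighbour.\<close>

lemma star_edges_neighbour:
  assumes "star_lift n k a" "0 < n" "edge n (a i) z \<in> star_edges n k a"
  shows "z mod n = a (i + k) mod n \<or> z mod n = a (i + k + 1) mod n"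
proof -
  obtain m where "edge n (a i) z = edge n (a m) (a (m + k))"
    using assms(3) by (auto simp: star_edges_def)
  then consider "a i mod n = a m mod n" "z mod n = a (m + k) mod n"
    | "a i mod n = a (m + k) mod n" "z mod n = a m mod n"
    using edge_eq_iff[OF assms(2)] by blast
  then show ?thesis
  proof cases
    case 1
    then obtain q where q: "a i = a (m + q * (2 * k + 1))"
      using star_lift_eq_mod[OF assms(1)] by metis
    then have "i = m + q * (2 * k + 1)" using star_lift_eq[OF assms(1)] by blast
    then have "a (i + k) = a (m + k) + q * n"
      using star_lift_add_periods[OF assms(1), of "m + k" q] by (simp add: algebra_simps)
    with 1 show ?thesis by simp
  next
    case 2
    then obtain q where q: "a i = a (m + k + q * (2 * k + 1))"
      using star_lift_eq_mod[OF assms(1)] by metis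
    then have "i = m + k + q * (2 * k + 1)" using star_lift_eq[OF assms(1)] by blast
    then have "a (i + k + 1) = a m + (q + 1) * n"
      using star_lift_add_periods[OF assms(1), of m "q + 1"] by (simp add: algebra_simps)
    with 2 show ?thesis by (metis mod_mult_self1)
  qed
qed

text \<open>Gluing a chain \<open>U\<close> behind a chain \<open>T\<close>. The remaining
  inequalities \<open>x < y'\<close> and \<open>y < x' + n\<close> follow from
  \<open>x' < y' < x' + n\<close>, which holds inside \<open>U\<close>.\<close>

lemma edge_chain_Un:
  assumes "edge_chain n T" "edge_chain n U"
    and "\<And>x y x' y'. (x, y) \<in> T \<Longrightarrow> (x', y') \<in> U \<Longrightarrow> x < x' \<and> y < y' \<and> x' < y \<and> y' < x + n"
  shows "edge_chain n (T \<union> U)" and "card (T \<union> U) = card T + card U"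
proof -
  have T: "x < y' \<and> y < x' + n \<and> (x < x' \<and> y < y' \<or> x' < x \<and> y' < y \<or> x = x' \<and> y = y')"
    if "(x, y) \<in> T" "(x', y') \<in> T" for x y x' y'
    using assms(1) that unfolding edge_chain_def by fast
  have U: "x < y' \<and> y < x' + n \<and> (x < x' \<and> y < y' \<or> x' < x \<and> y' < y \<or> x = x' \<and> y = y')"
    if "(x, y) \<in> U" "(x', y') \<in> U" for x y x' y'
    using assms(2) that unfolding edge_chain_def by fast
  have TU: "x < y' \<and> y < x' + n \<and> x' < y \<and> y' < x + n \<and> x < x' \<and> y < y'"
    if "(x, y) \<in> T" "(x', y') \<in> U" for x y x' y'
    using assms(3)[OF that] T[OF that(1) that(1)] U[OF that(2) that(2)] by auto
  show "edge_chain n (T \<union> U)"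
    unfolding edge_chain_def
  proof (intro conjI ballI, goal_cases)
    case 1
    show ?case using assms(1,2) by (simp add: edge_chain_def)
  next
    case (2 p)
    obtain x y where p: "p = (x, y)" by fastforce
    show ?case unfolding p
    proof (clarify)
      fix x' y' assume "(x', y') \<in> T \<union> U"
      then show "x < y' \<and> y < x' + n \<and> (x < x' \<and> y < y' \<or> x' < x \<and> y' < y \<or> x = x' \<and> y = y')"
        using 2 T[of x y x' y'] U[of x y x' y'] TU[of x y x' y'] TU[of x' y' x y]
        unfolding p by blast
    qed
  qed
  have "T \<inter> U = {}" using TU by fastforce
  then show "card (T \<union> U) = card T + card U"
    using assms(1,2) by (simp add: edge_chain_def card_Un_disjoint)
qed

text \<open>A run of staircase corners: \<open>d = k\<close> gives the lower ends of consecutive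
  vertical segments, \<open>d = k + 1\<close> the upper ends.\<close>

definition star_chain :: "(int \<Rightarrow> int) \<Rightarrow> int \<Rightarrow> int \<Rightarrow> int \<Rightarrow> (int \<times> int) set" where
  "star_chain a d l u = (\<lambda>m. (a m, a (m + d))) ` {l..u}"

text \<open>The bounds put every first coordinate below every second one and keep the run within a
  period. For \<open>d = k\<close> and for \<open>d = k + 1\<close> they admit up to
  \<open>k\<close> members.\<close>

lemma edge_chain_star_chain:
  assumes "star_lift n k a" "u < l + d" "u + d < l + (2 * k + 1)"
  shows "edge_chain n (star_chain a d l u)"
proof -
  have "a m < a (m' + d) \<and> a (m + d) < a m' + n \<and>
      (a m < a m' \<and> a (m + d) < a (m' + d) \<or> a m' < a m \<and> a (m' + d) < a (m + d) \<or>
       a m = a m' \<and> a (m + d) = a (m' + d))"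
    if "m \<in> {l..u}" "m' \<in> {l..u}" for m m'
    using that assms(2,3)
    unfolding star_lift_period[OF assms(1), of m', symmetric] star_lift_less[OF assms(1)]
      star_lift_eq[OF assms(1)] by auto
  then show ?thesis unfolding edge_chain_def star_chain_def by auto
qed

lemma card_star_chain:
  assumes "star_lift n k a"
  shows "card (star_chain a d l u) = nat (u + 1 - l)"
proof -
  have "inj_on (\<lambda>m. (a m, a (m + d))) {l..u}"
    using star_lift_eq[OF assms] by (auto intro: inj_onI)
  then show ?thesis by (simp add: star_chain_def card_image)
qed

section \<open>Two stars without long chains\<close>

text \<open>Geometry enters only through \<open>no_long_chain\<close>, the form that the absence of
  \<open>(k + 1)\<close>-crossings takes on the unrolled circle.\<close>

locale star_pair =
  fixes n k :: int and a b :: "int \<Rightarrow> int"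
  assumes k_pos: "1 \<le> k"
    and lift_a: "star_lift n k a" and lift_b: "star_lift n k b"
    and distinct: "star_edges n k a \<noteq> star_edges n k b"
    and no_long_chain: "\<And>T. edge_chain n T \<Longrightarrow>
      (\<And>x y. (x, y) \<in> T \<Longrightarrow> edge n x y \<in> star_edges n k a \<union> star_edges n k b) \<Longrightarrow>
      int (card T) \<le> k"
begin

lemma star_pair_swap: "star_pair n k b a"
  using k_pos lift_a lift_b distinct no_long_chain by unfold_locales (auto simp: Un_commute)

lemma n_pos: "0 < n"
  using star_lift_window[OF lift_a, of 0 1] k_pos by simp

text \<open>A bisector of \<open>a\<close> at \<open>a i\<close> extends the \<open>k\<close> edges
  of \<open>a\<close> starting at \<open>a (i + 1)\<close> to \<open>a (i + k)\<close> to a chain of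
  \<open>k + 1\<close> members.\<close>

lemma bisector_not_edge:
  assumes "a (i + k) < z" "z < a (i + k + 1)"
  shows "edge n (a i) z \<notin> star_edges n k b"
proof
  assume e: "edge n (a i) z \<in> star_edges n k b"
  note less = star_lift_less[OF lift_a] and le = star_lift_le[OF lift_a]
  let ?U = "star_chain a k (i + 1) (i + k)"
  have wrap: "a (i + (2 * k + 1)) = a i + n" by (rule star_lift_period[OF lift_a])
  have iz: "a i < z" using assms(1) less[of i "i + k"] k_pos by linarith
  have zn: "z < a i + n"
    using assms(2) le[of "i + k + 1" "i + (2 * k + 1)"] wrap k_pos by linarith
  have T: "edge_chain n {(a i, z)}" using iz zn by (simp add: edge_chain_def)
  have U: "edge_chain n ?U" by (rule edge_chain_star_chain[OF lift_a]) auto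
  have TU: "x < x' \<and> y < y' \<and> x' < y \<and> y' < x + n"
    if TU: "(x, y) \<in> {(a i, z)}" "(x', y') \<in> ?U" for x y x' y'
  proof -
    obtain m where m: "i + 1 \<le> m" "m \<le> i + k" "x' = a m" "y' = a (m + k)"
      using TU by (auto simp: star_chain_def)
    show ?thesis
      using TU(1) m assms less[of i m] le[of "i + k + 1" "m + k"] le[of m "i + k"]
        less[of "m + k" "i + (2 * k + 1)"] wrap by auto
  qed
  note ch = edge_chain_Un[OF T U TU]
  have "int (card ({(a i, z)} \<union> ?U)) \<le> k"
    using e by (intro no_long_chain[OF ch(1)]) (auto simp: star_chain_def star_edges_lower)
  then show False using k_pos ch(2) card_star_chain[OF lift_a, of k "i + 1" "i + k"] by simp
qed

text \<open>Two stars sharing an angle agree: the two neighbouring angles then start with a common edge,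
  so they are shared as well, and this propagates around both stars.\<close>

lemma opposite_arcs_disjoint:
  assumes "a i = b j"
  shows "a (i + k + 1) \<le> b (j + k) \<or> b (j + k + 1) \<le> a (i + k)"
proof (rule ccontr)
  assume "\<not> ?thesis"
  then have overlap: "b (j + k) < a (i + k + 1)" "a (i + k) < b (j + k + 1)" by auto
  \<comment> \<open>Reindexing \<open>b\<close> gives the shared vertex the same index in both
    stars.\<close>
  define c where "c m = b (m + (j - i))" for m
  have c: "star_lift n k c" "star_edges n k c = star_edges n k b"
    unfolding c_def using star_lift_shift[OF lift_b] star_edges_shift by blast+
  interpret c: star_pair n k a c
    using k_pos lift_a c distinct no_long_chain by unfold_locales auto
  interpret c': star_pair n k c a by (rule c.star_pair_swap)
  \<comment> \<open>If two overlapping arcs differed at an end, an end of one would lie strictly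
    inside the other, making an edge of one star a bisector of the other.\<close>
  have same: "a (m + k) = c (m + k) \<and> a (m + k + 1) = c (m + k + 1)"
    if "a m = c m" "c (m + k) < a (m + k + 1)" "a (m + k) < c (m + k + 1)" for m
    using that c.bisector_not_edge[of m "c (m + k)"] c.bisector_not_edge[of m "c (m + k + 1)"]
      c'.bisector_not_edge[of m "a (m + k)"] c'.bisector_not_edge[of m "a (m + k + 1)"]
      star_edges_lower[of n a m k] star_edges_lower[of n c m k]
      star_edges_upper[OF lift_a, of m] star_edges_upper[OF c(1), of m]
    by (metis linorder_neqE)
  have same': "a (m + k + 1) = c (m + k + 1)" if "a m = c m" "a (m + k) = c (m + k)" for m
    using same[of m] that star_lift_less[OF lift_a, of "m + k" "m + k + 1"]
      star_lift_less[OF c(1), of "m + k" "m + k + 1"] by auto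
  have up: "a (i + int d) = c (i + int d) \<and> a (i + int d + k + 1) = c (i + int d + k + 1)" for d
  proof (induction d)
    case 0
    then show ?case using same[of i] assms overlap by (simp add: c_def algebra_simps)
  next
    case (Suc d)
    let ?m = "i + int d"
    have p: "a (?m + k + 1 + k) = a ?m + n" "c (?m + k + 1 + k) = c ?m + n"
      "a (?m + k + 1 + k + 1) = a (?m + 1) + n" "c (?m + k + 1 + k + 1) = c (?m + 1) + n"
      using star_lift_period[OF lift_a, of ?m] star_lift_period[OF c(1), of ?m]
        star_lift_period[OF lift_a, of "?m + 1"] star_lift_period[OF c(1), of "?m + 1"]
      by (simp_all add: algebra_simps)
    \<comment> \<open>At vertex \<open>?m + k + 1\<close> the lower neighbour is the shared vertex
      \<open>?m\<close>, a period later, so the upper neighbour \<open>?m + 1\<close> is shared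
      too.\<close>
    have 1: "a (?m + 1) = c (?m + 1)"
      using same'[of "?m + k + 1"] Suc unfolding p by simp
    have 2: "a (?m + 1 + k) = c (?m + 1 + k)" using Suc by (simp add: algebra_simps)
    show ?case using 1 same'[OF 1 2] by (simp add: algebra_simps)
  qed
  have "a m = c m" for m
  proof -
    \<comment> \<open>Only indices from \<open>i\<close> on are covered by \<open>up\<close>; adding
      \<open>q\<close> periods moves \<open>m\<close> there.\<close>
    define q where "q = \<bar>i - m\<bar>"
    have "q * 1 \<le> q * (2 * k + 1)" using k_pos by (intro mult_left_mono) (auto simp: q_def)
    then have "0 \<le> m + q * (2 * k + 1) - i"
      using abs_ge_self[of "i - m"] unfolding q_def[symmetric] by linarith
    then obtain d where "m + q * (2 * k + 1) - i = int d" by (rule nonneg_int_cases)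
    then have d: "m + q * (2 * k + 1) = i + int d" by simp
    show ?thesis
      using up[of d] star_lift_add_periods[OF lift_a, of m q] star_lift_add_periods[OF c(1), of m q]
      unfolding d by simp
  qed
  then have "a = c" by blast
  then show False using c(2) distinct by simp
qed

text \<open>The vertical segment of \<open>a\<close> at abscissa \<open>a i\<close> crosses the
  horizontal segment of \<open>b\<close> at height \<open>b j\<close>. The opposite kind of crossing
  turns into this one under the glide reflection.\<close>

definition arcs_cross :: "int \<Rightarrow> int \<Rightarrow> bool" where
  "arcs_cross i j \<longleftrightarrow> a (i + k) < b j \<and> b j < a (i + k + 1) \<and> b (j - k - 1) < a i \<and> a i < b (j - k)"

lemma arcs_cross_add_periods:
  "arcs_cross (i + q * (2 * k + 1)) (j + q * (2 * k + 1)) \<longleftrightarrow> arcs_cross i j"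
proof -
  note A = star_lift_add_periods[OF lift_a, of _ q] and B = star_lift_add_periods[OF lift_b, of _ q]
  show ?thesis
    using A[of i] A[of "i + k"] A[of "i + k + 1"] B[of j] B[of "j - k"] B[of "j - k - 1"]
    unfolding arcs_cross_def by (simp add: algebra_simps)
qed

lemma arcs_cross_mono:
  assumes "arcs_cross i j" "arcs_cross i' j'" "i < i'"
  shows "j < j'"
proof -
  have "a (i + k + 1) \<le> a (i' + k)" using star_lift_le[OF lift_a] assms(3) by simp
  then have "b j < b j'" using assms(1,2) unfolding arcs_cross_def by linarith
  then show ?thesis using star_lift_less[OF lift_b] by blast
qed

lemma arcs_cross_left_unique:
  assumes "arcs_cross i j" "arcs_cross i j'"
  shows "j = j'"
proof -
  have "b (j - k - 1) < b (j' - k)" "b (j' - k - 1) < b (j - k)"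
    using assms unfolding arcs_cross_def by linarith+
  then show ?thesis using star_lift_less[OF lift_b] by simp
qed

text \<open>Between the first crossing and its image under the glide reflection, one chain follows
  \<open>a\<close> up to the second crossing and then \<open>b\<close>, the other follows
  \<open>b\<close> and then \<open>a\<close>. Their lengths add up to \<open>2 * k + 2\<close>, so
  they cannot both be at most \<open>k\<close>.\<close>

lemma arcs_cross_not_close:
  assumes "arcs_cross i j" "arcs_cross i' j'" "i < i'" "i' \<le> i + k"
  shows False
proof -
  note lessa = star_lift_less[OF lift_a] and lea = star_lift_le[OF lift_a]
  note lessb = star_lift_less[OF lift_b] and leb = star_lift_le[OF lift_b]
  have c: "a (i + k) < b j" "b j < a (i + k + 1)" "b (j - k - 1) < a i" "a i < b (j - k)"
    using assms(1) by (auto simp: arcs_cross_def)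
  have c': "a (i' + k) < b j'" "b j' < a (i' + k + 1)" "b (j' - k - 1) < a i'" "a i' < b (j' - k)"
    using assms(2) by (auto simp: arcs_cross_def)
  have j: "j < j'" using arcs_cross_mono assms by blast
  have "b (j' - k - 1) < b j" using c' c lea[of i' "i + k"] assms(4) by linarith
  then have j': "j' \<le> j + k" using lessb by simp
  have wrap: "b (j - k - 1 + (2 * k + 1)) = b (j - k - 1) + n" "b (j - k + (2 * k + 1)) = b (j - k) + n"
    "a (i + (2 * k + 1)) = a i + n"
    using star_lift_period lift_a lift_b by blast+
  have wrap': "b (j + k) = b (j - k - 1) + n" using wrap(1) by (simp add: algebra_simps)
  \<comment> \<open>Corners of \<open>a\<close> between the two crossings, then corners of
    \<open>b\<close> from the second crossing to the image of the first.\<close>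
  let ?T = "star_chain a (k + 1) i (i' - 1)" and ?U = "star_chain b k (j' - k) j"
  have T: "edge_chain n ?T" by (rule edge_chain_star_chain[OF lift_a]) (use assms in auto)
  have U: "edge_chain n ?U" by (rule edge_chain_star_chain[OF lift_b]) (use j in auto)
  have TU: "x < x' \<and> y < y' \<and> x' < y \<and> y' < x + n" if TU: "(x, y) \<in> ?T" "(x', y') \<in> ?U"
    for x y x' y'
  proof -
    obtain m where m: "i \<le> m" "m \<le> i' - 1" "x = a m" "y = a (m + k + 1)"
      using TU by (auto simp: star_chain_def simp flip: add.assoc)
    obtain m' where m': "j' - k \<le> m'" "m' \<le> j" "x' = b m'" "y' = b (m' + k)"
      using TU by (auto simp: star_chain_def)
    have "x < x'" using m m' c' lea[of m i'] leb[of "j' - k" m'] by simp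
    moreover have "y < y'" using m m' c' lea[of "m + k + 1" "i' + k"] leb[of j' "m' + k"] by simp
    moreover have "x' < y" using m m' c lea[of "i + k + 1" "m + k + 1"] leb[of m' j] by simp
    moreover have "y' < x + n" using m m' c lea[of i m] leb[of "m' + k" "j + k"] wrap' by simp
    ultimately show ?thesis by blast
  qed
  have "int (card (?T \<union> ?U)) \<le> k"
    by (rule no_long_chain[OF edge_chain_Un(1)[OF T U TU]])
      (use star_edges_upper[OF lift_a] in
        \<open>auto simp: star_chain_def star_edges_lower simp flip: add.assoc\<close>)
  then have 1: "(i' - i) + (j + k + 1 - j') \<le> k"
    using edge_chain_Un(2)[OF T U TU] card_star_chain[OF lift_a, of "k + 1" i "i' - 1"]
      card_star_chain[OF lift_b, of k "j' - k" j] assms(3) j' by simp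
  \<comment> \<open>The complementary choice: \<open>b\<close> between the crossings,
    \<open>a\<close> afterwards.\<close>
  let ?T' = "star_chain b (k + 1) (j - k) (j' - k - 1)" and ?U' = "star_chain a (k + 1) i' (i + k)"
  have T': "edge_chain n ?T'" by (rule edge_chain_star_chain[OF lift_b]) (use j' in auto)
  have U': "edge_chain n ?U'" by (rule edge_chain_star_chain[OF lift_a]) (use assms(3) in auto)
  have TU': "x < x' \<and> y < y' \<and> x' < y \<and> y' < x + n"
    if TU: "(x, y) \<in> ?T'" "(x', y') \<in> ?U'" for x y x' y'
  proof -
    obtain m where m: "j - k \<le> m" "m \<le> j' - k - 1" "x = b m" "y = b (m + k + 1)"
      using TU by (auto simp: star_chain_def simp flip: add.assoc)
    obtain m' where m': "i' \<le> m'" "m' \<le> i + k" "x' = a m'" "y' = a (m' + k + 1)"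
      using TU by (auto simp: star_chain_def simp flip: add.assoc)
    have "x < x'" using m m' c' lea[of i' m'] leb[of m "j' - k - 1"] by simp
    moreover have "y < y'" using m m' c' lea[of "i' + k + 1" "m' + k + 1"] leb[of "m + k + 1" j'] by simp
    moreover have "x' < y" using m m' c lea[of m' "i + k"] leb[of j "m + k + 1"] by simp
    moreover have "y' < x + n"
      using m m' c lea[of "m' + k + 1" "i + (2 * k + 1)"] leb[of "j - k" m] wrap by simp
    ultimately show ?thesis by blast
  qed
  have "int (card (?T' \<union> ?U')) \<le> k"
    by (rule no_long_chain[OF edge_chain_Un(1)[OF T' U' TU']])
      (use star_edges_upper[OF lift_a] star_edges_upper[OF lift_b] in
        \<open>auto simp: star_chain_def simp flip: add.assoc\<close>)
  then have 2: "(j' - j) + (i + k + 1 - i') \<le> k"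
    using edge_chain_Un(2)[OF T' U' TU'] card_star_chain[OF lift_b, of "k + 1" "j - k" "j' - k - 1"]
      card_star_chain[OF lift_a, of "k + 1" i' "i + k"] assms(4) j by simp
  show False using 1 2 by linarith
qed

text \<open>Modulo \<open>2 * k + 1\<close>, two different indices have a gap of at most
  \<open>k\<close> on one side or the other, and \<open>arcs_cross_not_close\<close> excludes both
  cases.\<close>

lemma arcs_cross_unique:
  assumes "arcs_cross i j" "arcs_cross i' j'"
  obtains q where "i' = i + q * (2 * k + 1)" "j' = j + q * (2 * k + 1)"
proof -
  define q where "q = (i' - i) div (2 * k + 1)"
  define h where "h = i + q * (2 * k + 1)"
  have h: "i' - h = (i' - i) mod (2 * k + 1)"
    unfolding h_def q_def by (simp add: minus_div_mult_eq_mod[symmetric] algebra_simps)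
  have "0 \<le> i' - h" "i' - h < 2 * k + 1" unfolding h using k_pos by (simp_all del: zle_add1_eq_le)
  moreover have hj: "arcs_cross h (j + q * (2 * k + 1))"
    unfolding h_def by (simp only: arcs_cross_add_periods assms(1))
  moreover have "arcs_cross (h + (2 * k + 1)) (j + q * (2 * k + 1) + (2 * k + 1))"
    using arcs_cross_add_periods[of h 1 "j + q * (2 * k + 1)"] hj by simp
  ultimately have "i' = h"
    using arcs_cross_not_close[OF _ assms(2), of h] arcs_cross_not_close[OF assms(2)]
    by (smt (verit))
  then show thesis
    using that[of q] arcs_cross_left_unique[of h "j + q * (2 * k + 1)" j'] hj assms(2)
    unfolding h_def by simp
qed

lemma arcs_cross_exists: "\<exists>i j. arcs_cross i j"
proof -
  obtain I where I: "\<And>x. a (I x) \<le> x" "\<And>x. x < a (I x + 1)"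
    using star_lift_floor[OF lift_a] by metis
  obtain J where J: "\<And>x. b (J x) \<le> x" "\<And>x. x < b (J x + 1)"
    using star_lift_floor[OF lift_b] by metis
  \<comment> \<open>the heights of the two staircases over the open interval from \<open>x\<close> to \<open>x + 1\<close>\<close>
  define \<alpha> where "\<alpha> x = a (I x + k + 1)" for x
  define \<beta> where "\<beta> x = b (J x + k + 1)" for x
  note lessa = star_lift_less[OF lift_a] and lea = star_lift_le[OF lift_a]
  note lessb = star_lift_less[OF lift_b] and leb = star_lift_le[OF lift_b]
  have Iuniq: "I x = i" if "a i \<le> x" "x < a (i + 1)" for x i
  proof -
    have "a i < a (I x + 1)" "a (I x) < a (i + 1)" using that I[of x] by linarith+
    then show ?thesis using lessa by simp
  qed
  have Juniq: "J x = j" if "b j \<le> x" "x < b (j + 1)" for x j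
  proof -
    have "b j < b (J x + 1)" "b (J x) < b (j + 1)" using that J[of x] by linarith+
    then show ?thesis using lessb by simp
  qed
  have wrapa: "a (i + k + 1 + k) = a i + n" "a (i + k + 1 + k + 1) = a (i + 1) + n" for i
    using star_lift_period[OF lift_a, of i] star_lift_period[OF lift_a, of "i + 1"]
    by (simp_all add: algebra_simps)
  have wrapb: "b (i + k + 1 + k) = b i + n" "b (i + k + 1 + k + 1) = b (i + 1) + n" for i
    using star_lift_period[OF lift_b, of i] star_lift_period[OF lift_b, of "i + 1"]
    by (simp_all add: algebra_simps)
  \<comment> \<open>Equal heights mean a shared vertex, and the arcs opposite to it would both
    contain the interval from \<open>x + n\<close> to \<open>x + n + 1\<close>.\<close>
  have ne: "\<alpha> x \<noteq> \<beta> x" for x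
  proof
    assume "\<alpha> x = \<beta> x"
    then have "a (I x + 1) \<le> b (J x) \<or> b (J x + 1) \<le> a (I x)"
      using opposite_arcs_disjoint[of "I x + k + 1" "J x + k + 1"]
      unfolding \<alpha>_def \<beta>_def wrapa wrapb by simp
    then show False using I[of x] J[of x] by linarith
  qed
  \<comment> \<open>The glide reflection reverses which staircase is higher; \<open>x + n\<close>
    separates the two heights at \<open>\<alpha> x\<close>.\<close>
  have flip_a: "\<beta> (\<alpha> x) < \<alpha> (\<alpha> x)" if "\<alpha> x < \<beta> x" for x
  proof -
    have "b (J (\<alpha> x)) < b (J x + k + 1)" using that J(1)[of "\<alpha> x"] by (simp add: \<beta>_def)
    then have "J (\<alpha> x) \<le> J x + k" using lessb by simp
    then have "\<beta> (\<alpha> x) \<le> b (J x + k + 1 + k)" unfolding \<beta>_def leb by simp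
    also have "\<dots> \<le> x + n" using J(1)[of x] wrapb by simp
    also have "\<dots> < a (I x + k + 1 + k + 1)" using I(2)[of x] wrapa by simp
    also have "\<dots> = \<alpha> (\<alpha> x)"
      using Iuniq[of "I x + k + 1" "\<alpha> x"] lessa[of "I x + k + 1" "I x + k + 1 + 1"]
      by (simp add: \<alpha>_def)
    finally show ?thesis .
  qed
  have flip_b: "\<alpha> (\<beta> x) < \<beta> (\<beta> x)" if "\<beta> x < \<alpha> x" for x
  proof -
    have "a (I (\<beta> x)) < a (I x + k + 1)" using that I(1)[of "\<beta> x"] by (simp add: \<alpha>_def)
    then have "I (\<beta> x) \<le> I x + k" using lessa by simp
    then have "\<alpha> (\<beta> x) \<le> a (I x + k + 1 + k)" unfolding \<alpha>_def lea by simp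
    also have "\<dots> \<le> x + n" using I(1)[of x] wrapa by simp
    also have "\<dots> < b (J x + k + 1 + k + 1)" using J(2)[of x] wrapb by simp
    also have "\<dots> = \<beta> (\<beta> x)"
      using Juniq[of "J x + k + 1" "\<beta> x"] lessb[of "J x + k + 1" "J x + k + 1 + 1"]
      by (simp add: \<beta>_def)
    finally show ?thesis .
  qed
  have above: "x < \<alpha> x" for x
    using I(2)[of x] lea[of "I x + 1" "I x + k + 1"] k_pos by (simp add: \<alpha>_def)
  obtain x0 where x0: "\<alpha> x0 < \<beta> x0" using flip_b ne by (metis linorder_neqE)
  define x1 where "x1 = \<alpha> x0"
  have x1: "x0 \<le> x1" "\<beta> x1 < \<alpha> x1" using above[of x0] flip_a[OF x0] by (auto simp: x1_def)
  \<comment> \<open>A discrete intermediate value argument: the order of the heights changes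
    somewhere between \<open>x0\<close> and \<open>x1\<close>.\<close>
  have "\<exists>x. \<alpha> (x - 1) < \<beta> (x - 1) \<and> \<beta> x < \<alpha> x"
  proof (rule ccontr)
    assume no: "\<not> ?thesis"
    have "\<alpha> (x0 + int d) < \<beta> (x0 + int d)" for d
    proof (induction d)
      case (Suc d)
      have "x0 + int (Suc d) - 1 = x0 + int d" by simp
      then have "\<not> \<beta> (x0 + int (Suc d)) < \<alpha> (x0 + int (Suc d))"
        using no Suc by metis
      then show ?case using ne by (metis linorder_neqE)
    qed (use x0 in simp)
    from this[of "nat (x1 - x0)"] x1 show False by simp
  qed
  then obtain x where x: "\<alpha> (x - 1) < \<beta> (x - 1)" "\<beta> x < \<alpha> x" by blast
  have Istep: "I (x - 1) = (if a (I x) = x then I x - 1 else I x)"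
    using I[of x] lessa[of "I x - 1" "I x"] by (auto intro!: Iuniq)
  have Jstep: "J (x - 1) = (if b (J x) = x then J x - 1 else J x)"
    using J[of x] lessb[of "J x - 1" "J x"] by (auto intro!: Juniq)
  \<comment> \<open>Heights never decrease, so the change of order forces \<open>\<alpha>\<close> to
    jump at \<open>x\<close>; hence \<open>x\<close> is a vertex of \<open>a\<close>.\<close>
  have "\<beta> (x - 1) \<le> \<beta> x" unfolding \<beta>_def leb Jstep by simp
  then have ax: "a (I x) = x" "I (x - 1) = I x - 1"
    using x Istep unfolding \<alpha>_def by (auto split: if_splits)
  then have a1: "\<alpha> (x - 1) = a (I x + k)" by (simp add: \<alpha>_def)
  \<comment> \<open>If \<open>\<beta>\<close> jumped there as well, \<open>x\<close> would be a
    shared vertex with the arc of \<open>b\<close> nested in that of \<open>a\<close>.\<close>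
  have bx: "b (J x) \<noteq> x"
  proof
    assume e: "b (J x) = x"
    then have "\<beta> (x - 1) = b (J x + k)" using Jstep by (simp add: \<beta>_def)
    then show False
      using opposite_arcs_disjoint[of "I x" "J x"] x a1 ax e
        lessb[of "J x + k" "J x + k + 1"] lessa[of "I x + k" "I x + k + 1"]
      unfolding \<alpha>_def \<beta>_def by auto
  qed
  then have b1: "\<beta> (x - 1) = b (J x + k + 1)" using Jstep by (simp add: \<beta>_def)
  have "arcs_cross (I x) (J x + k + 1)"
    unfolding arcs_cross_def using x a1 b1 ax bx J[of x] by (simp add: \<alpha>_def \<beta>_def)
  then show ?thesis by blast
qed

end

section \<open>Passing to the polygon\<close>

lemma int_mod_neq:
  fixes n x y :: int
  assumes "x < y" "y < x + n"
  shows "x mod n \<noteq> y mod n"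
proof
  assume "x mod n = y mod n"
  then have "n dvd y - x" by (metis mod_eq_dvd_iff)
  then show False using zdvd_not_zless[of "y - x" n] assms by simp
qed

lemma ccw_mod:
  fixes n x y z :: int
  assumes "x < y" "y < z" "z < x + n"
  shows "ccw (nat (x mod n)) (nat (y mod n)) (nat (z mod n))"
proof -
  have n: "0 < n" using assms by linarith
  have bounds: "0 \<le> w mod n" "w mod n < n" for w using n by simp_all
  have step: "w mod n = (if x mod n + (w - x) < n then x mod n + (w - x) else x mod n + (w - x) - n)"
    if "x < w" "w < x + n" for w
  proof -
    define v where "v = x mod n + (w - x)"
    have e: "w mod n = v mod n" unfolding v_def by (simp add: mod_add_left_eq)
    have v: "0 \<le> v" "v < n + n" using that bounds[of x] unfolding v_def by linarith+
    have "v mod n = (v - n) mod n" by simp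
    then have "v mod n = (if v < n then v else v - n)"
      using v mod_pos_pos_trivial[of v n] mod_pos_pos_trivial[of "v - n" n] by auto
    then show ?thesis unfolding e v_def .
  qed
  show ?thesis
    using step[of y] step[of z] assms bounds[of x] bounds[of y] bounds[of z]
    unfolding ccw_def nat_less_eq_zless[OF bounds(1)] by (simp split: if_splits)
qed

lemma ccw_asym: "ccw x y z \<Longrightarrow> \<not> ccw x z y"
  by (auto simp: ccw_def)

lemma ccw_distinct: "ccw x y z \<Longrightarrow> x \<noteq> y \<and> y \<noteq> z \<and> x \<noteq> z"
  by (auto simp: ccw_def)

lemma ccw_mod_between:
  fixes n x z :: int
  assumes "x < z" "z < x + n" "int t < n" "ccw (nat (x mod n)) t (nat (z mod n))"
  obtains w where "x < w" "w < z" "nat (w mod n) = t"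
proof -
  have n: "0 < n" using assms by linarith
  \<comment> \<open>The representative of \<open>t\<close> in the period starting at
    \<open>x\<close>; beyond \<open>z\<close> it would reverse the orientation of the
    triple.\<close>
  define w where "w = x + (int t - x) mod n"
  have "w mod n = int t" unfolding w_def using assms(3) by (simp add: mod_add_right_eq)
  then have t: "nat (w mod n) = t" by simp
  have w: "x \<le> w" "w < x + n" unfolding w_def using n by auto
  have "w \<noteq> x" "w \<noteq> z" using ccw_distinct[OF assms(4)] t by auto
  moreover have "\<not> z < w"
    using ccw_mod[of x z w n] assms ccw_asym t w by auto
  ultimately show thesis using that[of w] w t by auto
qed

text \<open>Each vertex \<open>a i\<close> has just two neighbours, hence a single angle, and its
  bisectors end in the open arc between these neighbours.\<close>

lemma is_bisector_star_edges:
  fixes n k :: nat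
  assumes "1 \<le> k" "star_lift (int n) (int k) a"
  shows "is_bisector n (star_edges (int n) (int k) a) e \<longleftrightarrow>
    (\<exists>i t. a (i + int k) < t \<and> t < a (i + int k + 1) \<and> e = edge (int n) (a i) t)"
proof
  let ?n = "int n" and ?k = "int k" and ?E = "star_edges (int n) (int k) a"
  have n: "0 < ?n" using star_lift_window[OF assms(2), of 0 1] assms(1) by simp
  define pr where "pr x = nat (x mod ?n)" for x
  have edge: "edge ?n x y = {pr x, pr y}" for x y by (simp add: edge_def pr_def)
  have pr_less: "pr x < n" for x using n by (simp add: pr_def nat_less_iff)
  have pr_int: "pr (int v) = v" if "v < n" for v using that by (simp add: pr_def nat_mod_distrib)
  have win: "a (i + ?k) < a (i + ?k + 1)" "a (i + ?k + 1) < a i + ?n" "a i < a (i + ?k)"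
    "a (i + ?k + 1) < a (i + ?k) + ?n" for i
    using star_lift_window[OF assms(2), of "i + ?k" "i + ?k + 1"]
      star_lift_window[OF assms(2), of i "i + ?k + 1"] star_lift_window[OF assms(2), of i "i + ?k"]
      assms(1) by auto
  \<comment> \<open>The upper neighbour comes first in the angle, because
    \<open>a (i + k + 1) < a i + n < a (i + k) + n\<close>.\<close>
  have ccw_angle: "ccw (pr (a (i + ?k + 1))) (pr (a i)) (pr (a (i + ?k)))" for i
    using ccw_mod[of "a (i + ?k + 1)" "a i + ?n" "a (i + ?k) + ?n" ?n] win[of i]
    by (simp add: pr_def)
  have nb: "v = pr (a (i + ?k)) \<or> v = pr (a (i + ?k + 1))" if "{pr (a i), v} \<in> ?E" "v < n" for i v
  proof -
    have "edge ?n (a i) (int v) \<in> ?E" using that by (simp add: edge pr_int)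
    from star_edges_neighbour[OF assms(2) n this] show ?thesis
      using pr_int[OF that(2)] unfolding pr_def by metis
  qed
  show "\<exists>i t. a (i + ?k) < t \<and> t < a (i + ?k + 1) \<and> e = edge ?n (a i) t" if bis: "is_bisector n ?E e"
  proof -
    obtain u v w t where ang: "is_angle n ?E u v w" and t: "t < n" "ccw w t u" "e = {v, t}"
      using bis unfolding is_bisector_def by blast
    have uvw: "u < n" "v < n" "w < n" "ccw u v w" "{u, v} \<in> ?E" "{v, w} \<in> ?E"
      using ang unfolding is_angle_def by auto
    obtain i where i: "v = pr (a i)"
      using uvw(5) unfolding star_edges_def edge by (auto simp: doubleton_eq_iff)
    have "u = pr (a (i + ?k)) \<or> u = pr (a (i + ?k + 1))" "w = pr (a (i + ?k)) \<or> w = pr (a (i + ?k + 1))"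
      using nb uvw i by (auto simp: insert_commute)
    moreover have "\<not> (u = pr (a (i + ?k)) \<and> w = pr (a (i + ?k + 1)))"
      using ccw_angle[of i] uvw(4) unfolding i ccw_def by linarith
    ultimately have "u = pr (a (i + ?k + 1))" "w = pr (a (i + ?k))"
      using ccw_distinct[OF uvw(4)] by auto
    then obtain t' where "a (i + ?k) < t'" "t' < a (i + ?k + 1)" "pr t' = t"
      using ccw_mod_between[of "a (i + ?k)" "a (i + ?k + 1)" ?n t] win[of i] t(1,2)
      unfolding pr_def by auto
    then show ?thesis using t(3) i edge by auto
  qed
  show "is_bisector n ?E e" if bis: "\<exists>i t. a (i + ?k) < t \<and> t < a (i + ?k + 1) \<and> e = edge ?n (a i) t"
  proof -
    obtain i t where t: "a (i + ?k) < t" "t < a (i + ?k + 1)" "e = edge ?n (a i) t"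
      using bis by blast
    let ?u = "pr (a (i + ?k + 1))" and ?v = "pr (a i)" and ?w = "pr (a (i + ?k))"
    have "{?u, ?v} \<in> ?E" "{?v, ?w} \<in> ?E"
      using star_edges_upper[OF assms(2), of i] star_edges_lower[of ?n a i ?k]
      by (simp_all add: edge insert_commute)
    moreover have "{?v, r} \<notin> ?E" if "r < n" "ccw ?w r ?u" for r
      using nb[OF _ that(1)] ccw_distinct[OF that(2)] by blast
    ultimately have "is_angle n ?E ?u ?v ?w"
      unfolding is_angle_def using pr_less ccw_angle by blast
    moreover have "ccw ?w (pr t) ?u"
      unfolding pr_def by (rule ccw_mod) (use t win[of i] in auto)
    ultimately show ?thesis
      unfolding is_bisector_def using t(3) edge pr_less by blast
  qed
qed

lemma k_star_lift:
  assumes "1 \<le> k" "k_star n k S"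
  obtains a where "star_lift (int n) (int k) a" "S = star_edges (int n) (int k) a"
proof -
  let ?n = "int n" and ?N = "2 * int k + 1"
  obtain s where s: "\<And>j. j < 2 * k + 1 \<Longrightarrow> s j < n"
    and ccw: "\<And>h i j. h < i \<Longrightarrow> i < j \<Longrightarrow> j < 2 * k + 1 \<Longrightarrow> ccw (s h) (s i) (s j)"
    and S: "S = {{s j, s ((j + k) mod (2 * k + 1))} | j. j < 2 * k + 1}"
    using assms(2) unfolding k_star_def by blast
  have n: "0 < ?n" using s[of 0] by simp
  \<comment> \<open>The counterclockwise distance from \<open>s 0\<close>; \<open>a\<close> adds
    \<open>n\<close> to it for every full turn through the indices.\<close>
  define d where "d r = (int (s (nat r)) - int (s 0)) mod ?n" for r
  define a where "a i = int (s 0) + d (i mod ?N) + (i div ?N) * ?n" for i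
  have dmod: "(int u - int (s 0)) mod ?n = (if s 0 \<le> u then int u - int (s 0) else int u - int (s 0) + ?n)"
    if "u < n" for u
  proof -
    have "(int u - int (s 0)) mod ?n = int u - int (s 0) + ?n" if "u < s 0"
    proof -
      have "(int u - int (s 0)) mod ?n = (int u - int (s 0) + ?n) mod ?n" by simp
      also have "\<dots> = int u - int (s 0) + ?n"
        by (rule mod_pos_pos_trivial) (use \<open>u < s 0\<close> s[of 0] in auto)
      finally show ?thesis .
    qed
    then show ?thesis using that by (auto simp: not_le)
  qed
  have d_bounds: "0 \<le> d r" "d r < ?n" for r using n by (auto simp: d_def)
  have d_ccw: "0 < d r \<and> d r < d r'" if "0 < r" "r < r'" "r' < ?N" for r r'
  proof -
    have "ccw (s 0) (s (nat r)) (s (nat r'))" "s (nat r) < n" "s (nat r') < n"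
      using that by (auto intro!: ccw s)
    then show ?thesis unfolding d_def using s[of 0] by (auto simp: dmod ccw_def)
  qed
  have d_mono: "d r < d r'" if "0 \<le> r" "r < r'" "r' < ?N" for r r'
  proof (cases "r = 0")
    case False
    then show ?thesis using d_ccw that by simp
  next
    case True
    \<comment> \<open>A companion index is needed to form a triple with \<open>0\<close> and
      \<open>r'\<close>: 2 if \<open>r' = 1\<close>, and 1 otherwise.\<close>
    have "0 < d r'" using d_ccw[of r' "r' + 1"] d_ccw[of 1 r'] assms(1) that
      by (cases "r' = 1") auto
    then show ?thesis using True by (simp add: d_def)
  qed
  have mono: "a i < a j" if "i < j" for i j
  proof (cases "i div ?N = j div ?N")
    case True
    have "i mod ?N < j mod ?N"
      using that True by (metis add_less_cancel_left mult_div_mod_eq)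
    then show ?thesis 
      unfolding a_def True using d_mono[of "i mod ?N" "j mod ?N"]
      by (simp del: zle_add1_eq_le)
  next
    case False
    then have "i div ?N + 1 \<le> j div ?N" using that zdiv_mono1[of i j ?N] by simp
    then have "(i div ?N + 1) * ?n \<le> (j div ?N) * ?n" using n by (intro mult_right_mono) auto
    then show ?thesis
      unfolding a_def using d_bounds[of "i mod ?N"] d_bounds[of "j mod ?N"]
      by (simp add: distrib_right)
  qed
  have "a (i + ?N) = a i + ?n" for i
    by (simp add: a_def distrib_right div_add_self2)
  then have lift: "star_lift ?n (int k) a"
    using mono by (simp add: star_lift_def strict_mono_def)
  have idx: "nat (i mod ?N) < 2 * k + 1" for i
    using pos_mod_bound[of ?N i] by linarith
  have a_mod: "nat (a i mod ?n) = s (nat (i mod ?N))" for i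
  proof -
    have "a i mod ?n = int (s (nat (i mod ?N))) mod ?n"
      unfolding a_def d_def by (simp add: mod_add_right_eq)
    also have "\<dots> = int (s (nat (i mod ?N)))"
      using s[OF idx[of i]] by simp
    finally show ?thesis by simp
  qed
  have edge: "edge ?n (a i) (a (i + int k)) =
      {s (nat (i mod ?N)), s ((nat (i mod ?N) + k) mod (2 * k + 1))}" for i
  proof -
    have "int ((nat (i mod ?N) + k) mod (2 * k + 1)) = (i mod ?N + int k) mod ?N"
      by (simp add: zmod_int add.commute)
    then have "nat ((i + int k) mod ?N) = (nat (i mod ?N) + k) mod (2 * k + 1)"
      by (metis mod_add_left_eq nat_int)
    then show ?thesis unfolding edge_def a_mod by simp
  qed
  have "S = star_edges ?n (int k) a"
  proof (intro equalityI subsetI)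
    fix e assume "e \<in> S"
    then obtain j where j: "j < 2 * k + 1" "e = {s j, s ((j + k) mod (2 * k + 1))}"
      unfolding S by blast
    then have "e = edge ?n (a (int j)) (a (int j + int k))" unfolding edge by simp
    then show "e \<in> star_edges ?n (int k) a" by (simp add: star_edges_def)
  next
    fix e assume "e \<in> star_edges ?n (int k) a"
    then obtain i where "e = edge ?n (a i) (a (i + int k))" by (auto simp: star_edges_def)
    then show "e \<in> S" unfolding edge S using idx by blast
  qed
  with lift show thesis by (rule that)
qed

text \<open>Weighted by the areas of the triangles omitting them, four points in the plane satisfy
  an affine dependence with alternating signs. Positive areas place the resulting Radon point on
  both segments.\<close>

lemma cis_segments_cross:
  assumes "t0 < t1" "t1 < t2" "t2 < t3" "t3 < t0 + 2 * pi"
  shows "open_segment (cis t0) (cis t2) \<inter> open_segment (cis t1) (cis t3) \<noteq> {}"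
proof -
  \<comment> \<open>Twice the signed area of the triangle \<open>p q r\<close>.\<close>
  define D where "D p q r = (Re q - Re p) * (Im r - Im p) - (Im q - Im p) * (Re r - Re p)" for p q r
  have D_pos: "0 < D (cis x) (cis y) (cis z)" if "x < y" "y < z" "z < x + 2 * pi" for x y z
  proof -
    define u v where "u = (y - x) / 2" and "v = (z - y) / 2"
    have "D (cis x) (cis y) (cis z) = sin (y - x) + sin (z - y) - sin (z - x)"
      by (simp add: D_def sin_diff algebra_simps)
    also have "\<dots> = sin (2 * u) + sin (2 * v) - sin (2 * u + 2 * v)"
    proof -
      have "y - x = 2 * u" "z - y = 2 * v" "z - x = 2 * u + 2 * v"
        unfolding u_def v_def by (simp_all add: field_simps)
      then show ?thesis by (simp only:)
    qed
    also have "\<dots> = 4 * sin u * sin v * sin (u + v)"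
      unfolding sin_add cos_double_sin sin_double by (simp add: algebra_simps power2_eq_square)
    also have "\<dots> > 0"
    proof -
      have "0 < u" "0 < v" "u + v < pi" using that by (auto simp: u_def v_def field_simps)
      then show ?thesis by (intro mult_pos_pos sin_gt_zero) auto
    qed
    finally show ?thesis .
  qed
  define d0 d1 d2 d3 where
    "d0 = D (cis t1) (cis t2) (cis t3)" and "d1 = D (cis t0) (cis t2) (cis t3)" and
    "d2 = D (cis t0) (cis t1) (cis t3)" and "d3 = D (cis t0) (cis t1) (cis t2)"
  have pos: "0 < d0" "0 < d1" "0 < d2" "0 < d3"
    unfolding d0_def d1_def d2_def d3_def using assms by (auto intro!: D_pos)
  have sum: "d0 + d2 = d1 + d3"
    unfolding d0_def d1_def d2_def d3_def D_def by (simp add: algebra_simps)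
  have bal: "d0 *\<^sub>R cis t0 + d2 *\<^sub>R cis t2 = d1 *\<^sub>R cis t1 + d3 *\<^sub>R cis t3"
    unfolding d0_def d1_def d2_def d3_def D_def by (simp add: complex_eq_iff algebra_simps)
  have D_ne: "p \<noteq> q" "p \<noteq> r" "q \<noteq> r" if "0 < D p q r" for p q r
    using that by (auto simp: D_def)
  have ne: "cis t0 \<noteq> cis t2" "cis t1 \<noteq> cis t3"
    using D_ne pos unfolding d0_def d3_def by blast+
  have seg: "inverse (c + d) *\<^sub>R (c *\<^sub>R p + d *\<^sub>R q) \<in> open_segment p q"
    if "0 < c" "0 < d" "p \<noteq> q" for c d and p q :: complex
    unfolding in_segment
  proof (intro conjI exI[of _ "d / (c + d)"])
    have "1 - d / (c + d) = c / (c + d)" using that by (simp add: field_simps)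
    then show "inverse (c + d) *\<^sub>R (c *\<^sub>R p + d *\<^sub>R q) = (1 - d / (c + d)) *\<^sub>R p + (d / (c + d)) *\<^sub>R q"
      by (simp add: scaleR_add_right divide_inverse mult.commute)
  qed (use that in auto)
  have "inverse (d0 + d2) *\<^sub>R (d0 *\<^sub>R cis t0 + d2 *\<^sub>R cis t2) \<in> open_segment (cis t0) (cis t2)"
    using seg pos ne by blast
  moreover have "inverse (d0 + d2) *\<^sub>R (d0 *\<^sub>R cis t0 + d2 *\<^sub>R cis t2) \<in> open_segment (cis t1) (cis t3)"
    unfolding sum bal using seg pos ne by blast
  ultimately show ?thesis by blast
qed

lemma crosses_edge:
  fixes n :: nat
  assumes "convex_ngon n P" "x < x'" "x' < y" "y < y'" "y' < x + int n"
  shows "crosses P (edge (int n) x y) (edge (int n) x' y')"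
proof -
  let ?n = "int n"
  have n: "0 < ?n" using assms by linarith
  obtain \<theta> :: "nat \<Rightarrow> real" where \<theta>: "\<And>i. i < n \<Longrightarrow> P i = cis (\<theta> i)"
    "strict_mono_on {..<n} \<theta>" "\<And>i j. i < n \<Longrightarrow> j < n \<Longrightarrow> \<theta> j < \<theta> i + 2 * pi"
    using assms(1) unfolding convex_ngon_def by blast
  \<comment> \<open>The angles continued to all integers, gaining a full turn per period; this makes
    them strictly monotone.\<close>
  define \<Theta> where "\<Theta> z = \<theta> (nat (z mod ?n)) + 2 * pi * of_int (z div ?n)" for z
  have lt: "nat (z mod ?n) < n" for z using n by (simp add: nat_less_iff)
  have mono: "\<Theta> z < \<Theta> w" if "z < w" for z w
  proof (cases "z div ?n = w div ?n")
    case True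
    have "z mod ?n < w mod ?n"
      using that True by (metis add_less_cancel_left mult_div_mod_eq)
    moreover have "0 \<le> z mod ?n" using n by simp
    ultimately have "nat (z mod ?n) < nat (w mod ?n)" by linarith
    then have "\<theta> (nat (z mod ?n)) < \<theta> (nat (w mod ?n))"
      using \<theta>(2) lt by (auto simp: strict_mono_on_def)
    then show ?thesis unfolding \<Theta>_def True by simp
  next
    case False
    then have "z div ?n + 1 \<le> w div ?n" using that zdiv_mono1[of z w ?n] n by simp
    then have "of_int (z div ?n) + 1 \<le> (of_int (w div ?n) :: real)" by linarith
    then have "2 * pi * (of_int (z div ?n) + 1) \<le> 2 * pi * of_int (w div ?n)"
      by (intro mult_left_mono) auto
    then show ?thesis
      unfolding \<Theta>_def using \<theta>(3)[OF lt lt, of z w] by (simp add: distrib_left)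
  qed
  have \<Theta>n: "\<Theta> (x + ?n) = \<Theta> x + 2 * pi"
    using n by (simp add: \<Theta>_def distrib_left)
  have P: "P (nat (z mod ?n)) = cis (\<Theta> z)" for z
    unfolding \<Theta>_def cis_mult[symmetric] using \<theta>(1)[OF lt] by simp
  have "open_segment (cis (\<Theta> x)) (cis (\<Theta> y)) \<inter> open_segment (cis (\<Theta> x')) (cis (\<Theta> y')) \<noteq> {}"
    by (rule cis_segments_cross) (use mono assms in \<open>auto simp flip: \<Theta>n\<close>)
  then show ?thesis unfolding crosses_def edge_def P[symmetric] by blast
qed

lemma crosses_sym: "crosses P e f \<Longrightarrow> crosses P f e"
  unfolding crosses_def by blast

lemma crossing_free_chain_bound:
  fixes n l :: nat
  assumes "convex_ngon n P" "crossing_free P (l + 1) E"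
    and "edge_chain (int n) T" "\<And>x y. (x, y) \<in> T \<Longrightarrow> edge (int n) x y \<in> E"
  shows "card T \<le> l"
proof (rule ccontr)
  assume "\<not> card T \<le> l"
  \<comment> \<open>A crossing has an exact number of edges, so the chain is first cut down to
    \<open>l + 1\<close> members.\<close>
  then obtain U where U: "U \<subseteq> T" "card U = l + 1" "finite U"
    using obtain_subset_with_card_n[of "l + 1" T] by auto
  let ?f = "\<lambda>(x, y). edge (int n) x y"
  have cross: "crosses P (?f p) (?f q) \<and> ?f p \<noteq> ?f q" if "p \<in> U" "q \<in> U" "p \<noteq> q" for p q
  proof -
    obtain x y x' y' where pq: "p = (x, y)" "q = (x', y')" by fastforce
    have T: "(x, y) \<in> T" "(x', y') \<in> T" using that U pq by auto
    have c: "x < y'" "y < x' + int n" "x < x' \<and> y < y' \<or> x' < x \<and> y' < y"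
      using assms(3) T that(3) unfolding edge_chain_def pq by fast+
    have c': "x' < y" "y' < x + int n"
      using assms(3) T unfolding edge_chain_def by fast+
    \<comment> \<open>Different members also give different edges, so passing to edges preserves the
      cardinality.\<close>
    have d: "edge (int n) u v \<noteq> edge (int n) u' v'" if "u < u'" "u' < v" "v < v'" "v' < u + int n"
      for u v u' v'
      using that int_mod_neq[of u u' "int n"] int_mod_neq[of u v' "int n"]
        edge_eq_iff[of "int n" u v u' v'] by auto
    show ?thesis
      using c(3) crosses_edge[OF assms(1), of x x' y y'] crosses_edge[OF assms(1), of x' x y' y]
        crosses_sym d[of x x' y y'] d[of x' x y' y] c c' unfolding pq by auto
  qed
  have "inj_on ?f U" using cross by (meson inj_onI)
  moreover have "pairwise (crosses P) (?f ` U)"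
    unfolding pairwise_def using cross by blast
  ultimately have "is_crossing P (l + 1) (?f ` U)"
    unfolding is_crossing_def using U by (simp add: card_image)
  moreover have "?f ` U \<subseteq> E" using U assms(4) by auto
  ultimately show False using assms(2) unfolding crossing_free_def by blast
qed

text \<open>A common bisector whose two angles have the same apex contradicts
  \<open>opposite_arcs_disjoint\<close>; with the apexes at opposite ends it is a crossing
  point.\<close>

lemma (in star_pair) common_bisector_iff_arcs_cross:
  "(\<exists>i t. a (i + k) < t \<and> t < a (i + k + 1) \<and> e = edge n (a i) t) \<and>
   (\<exists>j t. b (j + k) < t \<and> t < b (j + k + 1) \<and> e = edge n (b j) t) \<longleftrightarrow>
   (\<exists>i j. arcs_cross i j \<and> e = edge n (a i) (b j))"
proof (intro iffI; (elim conjE exE)?)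
  fix i t j t'
  assume t: "a (i + k) < t" "t < a (i + k + 1)" "e = edge n (a i) t"
    and t': "b (j + k) < t'" "t' < b (j + k + 1)" "e = edge n (b j) t'"
  have ta: "a i < t" "t < a i + n"
    using t star_lift_window[OF lift_a, of i "i + k"] star_lift_window[OF lift_a, of i "i + k + 1"]
      k_pos by auto
  let ?h = "\<lambda>q. j + q * (2 * k + 1)"
  have shift: "b (?h q + k) < t' + q * n" "t' + q * n < b (?h q + k + 1)" for q
    using t' star_lift_add_periods[OF lift_b, of "j + k" q]
      star_lift_add_periods[OF lift_b, of "j + k + 1" q] by (simp_all add: algebra_simps)
  have near: "b (?h q) < t' + q * n" "t' + q * n < b (?h q) + n" for q
    using shift[of q] star_lift_window[OF lift_b, of "?h q" "?h q + k"]
      star_lift_window[OF lift_b, of "?h q" "?h q + k + 1"] k_pos by auto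
  have same: "x = y" if "x mod n = y mod n" "x < y + n" "y < x + n" for x y
    using that int_mod_neq[of x y n] int_mod_neq[of y x n] by (cases x y rule: linorder_cases) auto
  consider "a i mod n = b j mod n" "t mod n = t' mod n" | "a i mod n = t' mod n" "t mod n = b j mod n"
    using t(3) t'(3) edge_eq_iff[OF n_pos] by metis
  then show "\<exists>i j. arcs_cross i j \<and> e = edge n (a i) (b j)"
  proof cases
    case 1
    obtain q where q: "a i = b (j + q * (2 * k + 1))" using star_lift_eq_mod[OF lift_b 1(1)] .
    have "t = t' + q * n" by (rule same) (use 1(2) ta near[of q] q in auto)
    then show ?thesis using opposite_arcs_disjoint[OF q] shift[of q] t by auto
  next
    case 2
    obtain q where q: "t = b (j + q * (2 * k + 1))" using star_lift_eq_mod[OF lift_b 2(2)] .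
    \<comment> \<open>The added \<open>n\<close> is needed since \<open>t' + q * n\<close> lies
      between \<open>t\<close> and \<open>t + n\<close>, whereas \<open>a i < t\<close>.\<close>
    have "a i + n = t' + q * n" by (rule same) (use 2(1) ta near[of q] q in auto)
    then have "b (?h q + k) < a i + n" "a i + n < b (?h q + k + 1)" using shift[of q] by auto
    moreover have "b (?h q + k) = b (?h q - k - 1) + n" "b (?h q + k + 1) = b (?h q - k) + n"
      using star_lift_period[OF lift_b, of "?h q - k - 1"] star_lift_period[OF lift_b, of "?h q - k"]
      by (simp_all add: algebra_simps)
    ultimately have "arcs_cross i (?h q)" unfolding arcs_cross_def using t q by simp
    then show ?thesis using t(3) q by blast
  qed
next
  fix i j assume c: "arcs_cross i j" "e = edge n (a i) (b j)"
  have "b (j + k) = b (j - k - 1) + n" "b (j + k + 1) = b (j - k) + n"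
    using star_lift_period[OF lift_b, of "j - k - 1"] star_lift_period[OF lift_b, of "j - k"]
    by (simp_all add: algebra_simps)
  then have "b (j + k) < a i + n \<and> a i + n < b (j + k + 1) \<and> e = edge n (b j) (a i + n)"
    using c by (simp add: arcs_cross_def edge_add_period edge_commute)
  then show "(\<exists>i t. a (i + k) < t \<and> t < a (i + k + 1) \<and> e = edge n (a i) t) \<and>
    (\<exists>j t. b (j + k) < t \<and> t < b (j + k + 1) \<and> e = edge n (b j) t)"
    using c unfolding arcs_cross_def by blast
qed

theorem theorem3p5:
  fixes n k :: nat and P :: "nat \<Rightarrow> complex" and R S :: "nat set set"
  assumes "k \<ge> 1" and "n \<ge> 2 * k + 1"
    and "convex_ngon n P"
    and "k_star n k R" and "k_star n k S" and "R \<noteq> S"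
    and "crossing_free P (k + 1) (R \<union> S)"
  shows "\<exists>!b. common_bisector n R S b"
proof -
  obtain a where a: "star_lift (int n) (int k) a" "R = star_edges (int n) (int k) a"
    using k_star_lift assms(1,4) by blast
  obtain b where b: "star_lift (int n) (int k) b" "S = star_edges (int n) (int k) b"
    using k_star_lift assms(1,5) by blast
  interpret star_pair "int n" "int k" a b
  proof
    fix T assume "edge_chain (int n) T"
      "\<And>x y. (x, y) \<in> T \<Longrightarrow> edge (int n) x y \<in> star_edges (int n) (int k) a \<union> star_edges (int n) (int k) b"
    then show "int (card T) \<le> int k"
      using crossing_free_chain_bound[OF assms(3,7)] a b by simp
  qed (use assms a b in auto)
  have cb: "common_bisector n R S e \<longleftrightarrow> (\<exists>i j. arcs_cross i j \<and> e = edge (int n) (a i) (b j))" for e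
    unfolding common_bisector_def a(2) b(2) is_bisector_star_edges[OF assms(1) a(1)]
      is_bisector_star_edges[OF assms(1) b(1)] by (rule common_bisector_iff_arcs_cross)
  \<comment> \<open>Crossings recur in every period, but translates by periods name the same polygon
    edge.\<close>
  have uniq: "edge (int n) (a i) (b j) = edge (int n) (a i') (b j')"
    if c: "arcs_cross i j" "arcs_cross i' j'" for i j i' j'
  proof -
    obtain q where "i' = i + q * (2 * int k + 1)" "j' = j + q * (2 * int k + 1)"
      using arcs_cross_unique[OF c] .
    then show ?thesis
      by (simp add: edge_def star_lift_add_periods[OF a(1)] star_lift_add_periods[OF b(1)])
  qed
  obtain i j where "arcs_cross i j" using arcs_cross_exists by blast
  then show ?thesis unfolding cb using uniq by blast
qed

end
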